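(* Let $V$ be a Hilbert space and $A$ a linear compact operator on $V$. Suppose that $V=\oplus_{k=1}^\infty V_k$ is a Hilbert sum such that $V_k$ is a finite dimensional subspace of $V$ for each $k\in\mathbb{N}$, and suppose that each orthogonal projection $P_k$ on $V_k$ commutes with $A$. If $f\in AA(\mathbb{R},V)$, then every bounded solution $y$ of $y'=Ay+f(t)$ belongs to $AA(\mathbb{R},V)$.
   Context: $AA(\mathbb{R},V)$ is the set of almost automorphic functions: continuous $\psi:\mathbb{R}\to V$ such that every real sequence has a subsequence $\{\tau_n\}$ for which $\tilde\psi(t)=\lim_n\psi(t+\tau_n)$ and $\psi(t)=\lim_n\tilde\psi(t-\tau_n)$ (pointwise) for all $t\in\mathbb{R}$. Solutions are defined on $\mathbb{R}$. *)

theory Defs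
  imports "HOL-Analysis.Analysis"
begin

text \<open>
  Hilbert spaces are the types of sort \<open>{real_inner, complete_space}\<close>. Complex Hilbert spaces are
  covered through their underlying real structure, with inner product \<open>Re \<langle>x, y\<rangle>\<close>: the norm,
  compactness and finite-dimensionality are unaffected, and for complex subspaces the orthogonal
  complement and the orthogonal projection are the same for both inner products.
\<close>

definition almost_automorphic :: "(real \<Rightarrow> 'a::real_normed_vector) \<Rightarrow> bool" where
  "almost_automorphic \<psi> \<longleftrightarrow>
     continuous_on UNIV \<psi> \<and>
     (\<forall>s :: nat \<Rightarrow> real. \<exists>r. strict_mono r \<and>
        (\<exists>\<psi>'. \<forall>t. (\<lambda>n. \<psi> (t + s (r n))) \<longlonglongrightarrow> \<psi>' t \<and>
                  (\<lambda>n. \<psi>' (t - s (r n))) \<longlonglongrightarrow> \<psi> t))"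

definition compact_operator :: "('a::real_normed_vector \<Rightarrow> 'b::real_normed_vector) \<Rightarrow> bool" where
  "compact_operator A \<longleftrightarrow> linear A \<and> (\<forall>S. bounded S \<longrightarrow> compact (closure (A ` S)))"

definition finite_dim_subspace :: "'a::real_vector set \<Rightarrow> bool" where
  "finite_dim_subspace W \<longleftrightarrow> (\<exists>B. finite B \<and> span B = W)"

definition hilbert_sum :: "(nat \<Rightarrow> 'a::real_inner set) \<Rightarrow> bool" where
  "hilbert_sum V \<longleftrightarrow>
     (\<forall>k. subspace (V k) \<and> closed (V k)) \<and>
     (\<forall>j k. j \<noteq> k \<longrightarrow> (\<forall>x\<in>V j. \<forall>y\<in>V k. orthogonal x y)) \<and>
     closure (span (\<Union>k. V k)) = UNIV"

definition orthogonal_projection_on :: "'a::real_inner set \<Rightarrow> ('a \<Rightarrow> 'a) \<Rightarrow> bool" where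
  "orthogonal_projection_on W P \<longleftrightarrow> (\<forall>x. P x \<in> W \<and> x - P x \<in> W\<^sup>\<bottom>)"

end

theory Submission
  imports Defs "HOL-Library.Diagonal_Subsequence" "HOL-Complex_Analysis.Great_Picard"
begin

text \<open>
  Each component \<open>P k \<circ> y\<close> is a bounded solution of a finite-dimensional equation. Translating it
  forth and back along a subsequence gives another bounded solution, which differs from it by a bounded
  homogeneous solution \<open>w\<close>. Since bounded homogeneous solutions are recovered by this procedure,
  iterating it adds \<open>w\<close> each time without increasing the supremum norm, hence \<open>w = 0\<close> and the
  components are almost automorphic. So the translates of \<open>y\<close> converge weakly along a common
  subsequence. As \<open>A\<close> is compact, differences of two such translates change less and less in time;
  a failure of strong convergence at one time would therefore persist at all times, and by the
  parallelogram law the weak limit would have a supremum norm smaller than that of \<open>y\<close>, which is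
  impossible since the translation can be undone.
\<close>

section \<open>Weak solutions\<close>

text \<open>The equation in integrated form, tested against each vector. Pointwise limits of
  translates of \<open>g\<close> may be discontinuous, so limits of solutions need not be
  differentiable; scalar integrals over compact intervals survive such limits by dominated
  convergence.\<close>

definition weak_solution ::
    "('a::real_inner \<Rightarrow> 'a) \<Rightarrow> (real \<Rightarrow> 'a) \<Rightarrow> (real \<Rightarrow> 'a) \<Rightarrow> bool" where
  "weak_solution A u g \<longleftrightarrow>
     (\<forall>a b x. a \<le> b \<longrightarrow> ((\<lambda>\<tau>. (A (u \<tau>) + g \<tau>) \<bullet> x) has_integral (u b - u a) \<bullet> x) {a..b})"

lemma weak_solutionD:
  "weak_solution A u g \<Longrightarrow> a \<le> b \<Longrightarrow>
     ((\<lambda>\<tau>. (A (u \<tau>) + g \<tau>) \<bullet> x) has_integral (u b - u a) \<bullet> x) {a..b}"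
  by (simp add: weak_solution_def)

lemma weak_solution_derivative:
  assumes "\<And>t. (u has_vector_derivative A (u t) + g t) (at t)"
  shows "weak_solution A u g"
  unfolding weak_solution_def
proof (intro allI impI)
  fix a b :: real and x :: 'a
  assume "a \<le> b"
  have "((\<lambda>t. u t \<bullet> x) has_vector_derivative (A (u t) + g t) \<bullet> x) (at t within {a..b})" for t
    using has_vector_derivative_at_within[OF bounded_linear.has_vector_derivative
        [OF bounded_linear_inner_left assms[of t]]] .
  from fundamental_theorem_of_calculus[OF \<open>a \<le> b\<close> this]
  show "((\<lambda>\<tau>. (A (u \<tau>) + g \<tau>) \<bullet> x) has_integral (u b - u a) \<bullet> x) {a..b}"
    by (simp add: inner_diff_left)
qed

lemma weak_solution_add:
  assumes "linear A" "weak_solution A u g" "weak_solution A v h"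
  shows "weak_solution A (\<lambda>t. u t + v t) (\<lambda>t. g t + h t)"
  unfolding weak_solution_def
proof (intro allI impI)
  fix a b :: real and x :: 'a
  assume "a \<le> b"
  have "((\<lambda>\<tau>. (A (u \<tau>) + g \<tau>) \<bullet> x + (A (v \<tau>) + h \<tau>) \<bullet> x) has_integral
      (u b - u a) \<bullet> x + (v b - v a) \<bullet> x) {a..b}"
    by (intro has_integral_add weak_solutionD assms \<open>a \<le> b\<close>)
  then show "((\<lambda>\<tau>. (A (u \<tau> + v \<tau>) + (g \<tau> + h \<tau>)) \<bullet> x) has_integral
      (u b + v b - (u a + v a)) \<bullet> x) {a..b}"
    by (simp add: linear_add[OF \<open>linear A\<close>] algebra_simps)
qed

lemma weak_solution_scaleR:
  assumes "linear A" "weak_solution A u g"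
  shows "weak_solution A (\<lambda>t. c *\<^sub>R u t) (\<lambda>t. c *\<^sub>R g t)"
  unfolding weak_solution_def
proof (intro allI impI)
  fix a b :: real and x :: 'a
  assume "a \<le> b"
  have "((\<lambda>\<tau>. c * ((A (u \<tau>) + g \<tau>) \<bullet> x)) has_integral c * ((u b - u a) \<bullet> x)) {a..b}"
    by (intro has_integral_mult_right weak_solutionD assms \<open>a \<le> b\<close>)
  then show "((\<lambda>\<tau>. (A (c *\<^sub>R u \<tau>) + c *\<^sub>R g \<tau>) \<bullet> x) has_integral
      (c *\<^sub>R u b - c *\<^sub>R u a) \<bullet> x) {a..b}"
    by (simp add: linear_scale[OF \<open>linear A\<close>] algebra_simps)
qed

lemma weak_solution_diff:
  assumes "linear A" "weak_solution A u g" "weak_solution A v h"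
  shows "weak_solution A (\<lambda>t. u t - v t) (\<lambda>t. g t - h t)"
  using weak_solution_add[OF assms(1,2) weak_solution_scaleR[OF assms(1,3), of "-1"]] by simp

lemma weak_solution_zero: "linear A \<Longrightarrow> weak_solution A (\<lambda>t. 0) (\<lambda>t. 0)"
  by (simp add: weak_solution_def linear_0)

lemma weak_solution_translate:
  assumes "weak_solution A u g"
  shows "weak_solution A (\<lambda>t. u (t + c)) (\<lambda>t. g (t + c))"
  unfolding weak_solution_def
proof (intro allI impI)
  fix a b :: real and x :: 'a
  assume "a \<le> b"
  then have "((\<lambda>\<tau>. (A (u \<tau>) + g \<tau>) \<bullet> x) has_integral (u (b + c) - u (a + c)) \<bullet> x) {a+c..b+c}"
    by (intro weak_solutionD assms) simp
  from has_integral_shift_real_ivl[OF this, of c]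
  show "((\<lambda>\<tau>. (A (u (\<tau> + c)) + g (\<tau> + c)) \<bullet> x) has_integral (u (b + c) - u (a + c)) \<bullet> x) {a..b}"
    by simp
qed

text \<open>Dominated convergence for each test vector: the bounds on \<open>u\<close> and
  \<open>g\<close> give the constant majorant \<open>(M * K + G) * norm x\<close>. Pointwise
  convergence is all that almost automorphy provides.\<close>

lemma weak_solution_limit:
  assumes A: "bounded_linear A"
    and sol: "\<And>n. weak_solution A (u n) (g n)"
    and bdd: "\<And>n t. norm (u n t) \<le> M" "\<And>n t. norm (g n t) \<le> G"
    and lim: "\<And>t. (\<lambda>n. u n t) \<longlonglongrightarrow> u' t" "\<And>t. (\<lambda>n. g n t) \<longlonglongrightarrow> g' t"
  shows "weak_solution A u' g'"
  unfolding weak_solution_def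
proof (intro allI impI)
  fix a b :: real and x :: 'a
  assume "a \<le> b"
  obtain K where K: "K > 0" "\<And>z. norm (A z) \<le> norm z * K"
    using bounded_linear.pos_bounded[OF A] by blast
  show "((\<lambda>\<tau>. (A (u' \<tau>) + g' \<tau>) \<bullet> x) has_integral (u' b - u' a) \<bullet> x) {a..b}"
  proof (rule has_integral_dominated_convergence)
    show "((\<lambda>\<tau>. (A (u n \<tau>) + g n \<tau>) \<bullet> x) has_integral (u n b - u n a) \<bullet> x) {a..b}" for n
      by (rule weak_solutionD[OF sol \<open>a \<le> b\<close>])
    show "(\<lambda>\<tau>. (M * K + G) * norm x) integrable_on {a..b}"
      by (rule integrable_const_ivl)
    show "\<forall>\<tau>\<in>{a..b}. norm ((A (u n \<tau>) + g n \<tau>) \<bullet> x) \<le> (M * K + G) * norm x" for n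
    proof
      fix \<tau>
      have "norm (A (u n \<tau>)) \<le> M * K"
        using K(2)[of "u n \<tau>"] mult_right_mono[OF bdd(1)[of n \<tau>], of K] K(1) by linarith
      then have "norm (A (u n \<tau>) + g n \<tau>) \<le> M * K + G"
        using bdd(2)[of n \<tau>] norm_triangle_ineq[of "A (u n \<tau>)" "g n \<tau>"] by linarith
      then show "norm ((A (u n \<tau>) + g n \<tau>) \<bullet> x) \<le> (M * K + G) * norm x"
        using Cauchy_Schwarz_ineq2[of "A (u n \<tau>) + g n \<tau>" x]
        by (smt (verit) mult_right_mono norm_ge_zero real_norm_def)
    qed
    show "\<forall>\<tau>\<in>{a..b}. (\<lambda>n. (A (u n \<tau>) + g n \<tau>) \<bullet> x) \<longlonglongrightarrow> (A (u' \<tau>) + g' \<tau>) \<bullet> x"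
      by (intro ballI tendsto_intros lim bounded_linear.tendsto[OF A])
    show "(\<lambda>n. (u n b - u n a) \<bullet> x) \<longlonglongrightarrow> (u' b - u' a) \<bullet> x"
      by (intro tendsto_intros lim)
  qed
qed

text \<open>Taking the increment \<open>u b - u a\<close> itself as test vector gives its squared
  norm on one side and \<open>c * (b - a)\<close> times its norm on the other; a factor cancels
  unless the increment vanishes.\<close>

lemma weak_solution_increment_le:
  assumes "weak_solution A u g" "a \<le> b"
    and c: "\<And>\<tau>. \<tau> \<in> {a..b} \<Longrightarrow> norm (A (u \<tau>) + g \<tau>) \<le> c"
  shows "norm (u b - u a) \<le> c * (b - a)"
proof (cases "u b = u a")
  case True
  have "0 \<le> c"
    using c[of a] \<open>a \<le> b\<close> norm_ge_zero[of "A (u a) + g a"] by (smt (verit) atLeastAtMost_iff)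
  with True \<open>a \<le> b\<close> show ?thesis by simp
next
  case False
  let ?x = "u b - u a"
  have "?x \<bullet> ?x \<le> (b - a) *\<^sub>R (c * norm ?x)"
  proof (rule has_integral_le)
    show "((\<lambda>\<tau>. (A (u \<tau>) + g \<tau>) \<bullet> ?x) has_integral ?x \<bullet> ?x) {a..b}"
      by (rule weak_solutionD[OF assms(1,2)])
    show "((\<lambda>\<tau>. c * norm ?x) has_integral (b - a) *\<^sub>R (c * norm ?x)) {a..b}"
      using has_integral_const_real[of "c * norm ?x" a b] \<open>a \<le> b\<close> by simp
    show "(A (u \<tau>) + g \<tau>) \<bullet> ?x \<le> c * norm ?x" if "\<tau> \<in> {a..b}" for \<tau>
      using norm_cauchy_schwarz[of "A (u \<tau>) + g \<tau>" ?x] mult_right_mono[OF c[OF that], of "norm ?x"]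
      by simp
  qed
  then have "norm ?x * norm ?x \<le> (c * (b - a)) * norm ?x"
    by (simp add: power2_norm_eq_inner[symmetric] power2_eq_square mult_ac)
  with False show ?thesis by simp
qed

lemma weak_solution_lipschitz:
  assumes "weak_solution A u g" "\<And>\<tau>. norm (A (u \<tau>) + g \<tau>) \<le> c"
  shows "norm (u s - u t) \<le> c * \<bar>s - t\<bar>"
proof (cases "s \<le> t")
  case True
  then show ?thesis
    using weak_solution_increment_le[OF assms(1) True assms(2)] by (simp add: norm_minus_commute)
next
  case False
  then show ?thesis
    using weak_solution_increment_le[OF assms(1) _ assms(2), of t s] by simp
qed

text \<open>Near a zero \<open>s\<close>, the increment estimate improves a bound
  \<open>M / 2 ^ n\<close> to \<open>M / 2 ^ Suc n\<close>, so the solution vanishes there. The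
  radius depends only on \<open>A\<close>, hence finitely many steps reach any time, forwards or
  backwards.\<close>

lemma homogeneous_unique:
  assumes A: "bounded_linear A" and w: "weak_solution A w (\<lambda>t. 0)"
    and M: "\<And>t. norm (w t) \<le> M" and 0: "w t0 = 0"
  shows "w t = 0"
proof -
  obtain K where K: "K > 0" "\<And>z. norm (A z) \<le> norm z * K"
    using bounded_linear.pos_bounded[OF A] by blast
  \<comment> \<open>With this radius each pass through the increment estimate halves the
    bound.\<close>
  define h where "h = 1 / (2 * K)"
  have "h > 0" and Kh: "K * h = 1/2" using K(1) by (auto simp: h_def)
  have M0: "0 \<le> M" using M[of 0] norm_ge_zero order_trans by blast
  have pow: "norm (w t) \<le> M / 2 ^ n" if "w s = 0" "\<bar>t - s\<bar> \<le> h" for s t n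
    using that(2)
  proof (induction n arbitrary: t)
    case 0
    then show ?case using M by simp
  next
    case (Suc n)
    have *: "norm (A (w \<tau>) + 0) \<le> M / 2 ^ n * K" if "\<bar>\<tau> - s\<bar> \<le> h" for \<tau>
      using K(2)[of "w \<tau>"] mult_right_mono[OF Suc.IH[OF that], of K] K(1) by simp
    have "norm (w t - w s) \<le> M / 2 ^ n * K * \<bar>t - s\<bar>"
    proof (cases "s \<le> t")
      case True
      show ?thesis
        using weak_solution_increment_le[OF w True, of "M / 2 ^ n * K"] * Suc.prems True by auto
    next
      case False
      then show ?thesis
        using weak_solution_increment_le[OF w, of t s "M / 2 ^ n * K"] * Suc.prems
        by (auto simp: norm_minus_commute)
    qed
    also have "\<dots> \<le> M / 2 ^ n * K * h"
      using Suc.prems K(1) M0 by (intro mult_left_mono) auto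
    also have "\<dots> = M / 2 ^ n * (K * h)" by simp
    also have "\<dots> = M / 2 ^ Suc n" by (simp only: Kh) simp
    finally show ?case using \<open>w s = 0\<close> by simp
  qed
  have step: "w t = 0" if "w s = 0" "\<bar>t - s\<bar> \<le> h" for s t
  proof -
    have "(\<lambda>n. M / 2 ^ n) \<longlonglongrightarrow> 0"
      by real_asymp
    then have "norm (w t) \<le> 0"
      by (rule LIMSEQ_le_const) (use pow[OF that] in blast)
    then show ?thesis by simp
  qed
  have "w t = 0" if "\<bar>t - t0\<bar> \<le> real n * h" for n t
    using that
  proof (induction n arbitrary: t)
    case 0
    then show ?case using 0(1) \<open>w t0 = 0\<close> by simp
  next
    case (Suc n)
    \<comment> \<open>The point that leaves the fraction \<open>1 / Suc n\<close> of the way to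
      \<open>t\<close>: it lies within \<open>real n * h\<close> of \<open>t0\<close>, and
      \<open>t\<close> lies within \<open>h\<close> of it.\<close>
    define s where "s = t0 + (t - t0) * (real n / real (Suc n))"
    have "\<bar>s - t0\<bar> = \<bar>t - t0\<bar> * (real n / real (Suc n))"
      by (simp add: s_def abs_mult)
    also have "\<dots> \<le> (real (Suc n) * h) * (real n / real (Suc n))"
      by (intro mult_right_mono Suc.prems) simp
    also have "\<dots> = real n * h" by simp
    finally have "w s = 0" by (rule Suc.IH)
    have "t - s = (t - t0) / real (Suc n)"
    proof -
      have "real n / real (Suc n) = 1 - 1 / real (Suc n)" by (simp add: field_simps)
      then show ?thesis unfolding s_def by (simp only: right_diff_distrib) simp
    qed
    then have "\<bar>t - s\<bar> \<le> h"
      using Suc.prems by (simp add: pos_divide_le_eq mult.commute del: of_nat_Suc)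
    with \<open>w s = 0\<close> show ?case by (rule step)
  qed
  moreover obtain n where "\<bar>t - t0\<bar> / h \<le> real n"
    using real_arch_simple by blast
  ultimately show ?thesis using \<open>h > 0\<close> by (simp add: field_simps)
qed

section \<open>Finite-dimensional equations\<close>

lemma finite_dim_orthogonal_basis:
  fixes F :: "'a::real_inner set"
  assumes "finite_dim_subspace F"
  obtains C where "finite C" "span C = F" "\<And>c. c \<in> C \<Longrightarrow> c \<noteq> 0"
    "\<And>x. x \<in> F \<Longrightarrow> x = (\<Sum>c\<in>C. (x \<bullet> c / (c \<bullet> c)) *\<^sub>R c)"
proof -
  obtain B where B: "finite B" "span B = F"
    using assms by (auto simp: finite_dim_subspace_def)
  obtain D where D: "finite D" "span D = span B" "pairwise orthogonal D"
    using basis_orthogonal[OF B(1)] by blast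
  \<comment> \<open>Gram-Schmidt may produce the zero vector; it is dropped since the coefficients
    divide by \<open>c \<bullet> c\<close>.\<close>
  define C where "C = D - {0}"
  have C: "finite C" "span C = F" "pairwise orthogonal C"
    using D B by (auto simp: C_def pairwise_def)
  have "x = (\<Sum>c\<in>C. (x \<bullet> c / (c \<bullet> c)) *\<^sub>R c)" if "x \<in> F" for x
  proof -
    have "x \<in> range (\<lambda>a. \<Sum>c\<in>C. a c *\<^sub>R c)"
      using that C(2) span_finite[OF C(1)] by simp
    then obtain a where a: "x = (\<Sum>c\<in>C. a c *\<^sub>R c)"
      by blast
    have "x \<bullet> c = a c * (c \<bullet> c)" if "c \<in> C" for c
    proof -
      have "x \<bullet> c = (\<Sum>d\<in>C. a d * (d \<bullet> c))" by (simp add: a inner_sum_left)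
      also have "\<dots> = (\<Sum>d\<in>C. if d = c then a c * (c \<bullet> c) else 0)"
        using C(3) that by (intro sum.cong) (auto simp: pairwise_def orthogonal_def)
      finally show ?thesis using C(1) that by simp
    qed
    then show ?thesis
      by (subst a, intro sum.cong) (auto simp: C_def)
  qed
  moreover have "c \<noteq> 0" if "c \<in> C" for c using that by (simp add: C_def)
  ultimately show ?thesis using that C(1,2) by blast
qed

lemma finite_dim_subspace_subset:
  assumes "finite_dim_subspace F" "subspace W" "W \<subseteq> F"
  shows "finite_dim_subspace W"
proof -
  obtain B where B: "finite B" "span B = F"
    using assms by (auto simp: finite_dim_subspace_def)
  obtain D where D: "D \<subseteq> W" "independent D" "W \<subseteq> span D"
    using maximal_independent_subset by blast
  have "finite D"
    using independent_span_bound[OF B(1) D(2)] D(1) assms(3) B(2) by auto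
  moreover have "span D = W"
    using D assms(2) span_minimal by blast
  ultimately show ?thesis by (auto simp: finite_dim_subspace_def)
qed

text \<open>A pointwise Arzela-Ascoli argument: a diagonal subsequence makes the finitely many
  coordinates converge at all rational times, and the common Lipschitz constant carries this over to
  all real times.\<close>

lemma lipschitz_convergent_subsequence:
  fixes u :: "nat \<Rightarrow> real \<Rightarrow> 'a::real_inner"
  assumes F: "finite_dim_subspace F" "\<And>n t. u n t \<in> F"
    and M: "\<And>n t. norm (u n t) \<le> M"
    and L: "\<And>n s t. norm (u n s - u n t) \<le> L * \<bar>s - t\<bar>"
  obtains r l where "strict_mono (r :: nat \<Rightarrow> nat)" "\<And>t. l t \<in> F"
    "\<And>t. (\<lambda>n. u (r n) t) \<longlonglongrightarrow> l t"
proof -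
  obtain C where C: "finite C" "span C = F"
    and expand: "\<And>x. x \<in> F \<Longrightarrow> x = (\<Sum>c\<in>C. (x \<bullet> c / (c \<bullet> c)) *\<^sub>R c)"
    using finite_dim_orthogonal_basis[OF F(1)] by metis
  have M0: "0 \<le> M" using M[of 0 0] norm_ge_zero order_trans by blast
  have L0: "0 \<le> L" using order_trans[OF norm_ge_zero L[of 0 1 0]] by simp
  obtain r :: "nat \<Rightarrow> nat" where r: "strict_mono r"
    and conv: "\<And>z. z \<in> \<rat> \<times> C \<Longrightarrow> \<exists>l. (\<lambda>n. u (r n) (fst z) \<bullet> snd z) \<longlonglongrightarrow> l"
  proof (rule function_convergent_subsequence[of "\<rat> \<times> C" "\<lambda>n z. u n (fst z) \<bullet> snd z"
        "M * (\<Sum>c\<in>C. norm c)"])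
    show "countable ((\<rat> :: real set) \<times> C)"
      using C(1) by (intro countable_SIGMA countable_rat countable_finite)
    fix n z assume z: "z \<in> (\<rat> :: real set) \<times> C"
    then have "norm (snd z) \<le> (\<Sum>c\<in>C. norm c)"
      using member_le_sum[of "snd z" C norm] C(1) by auto
    then show "norm (u n (fst z) \<bullet> snd z) \<le> M * (\<Sum>c\<in>C. norm c)"
      using Cauchy_Schwarz_ineq2[of "u n (fst z)" "snd z"] M[of n "fst z"] M0
        mult_mono[of "norm (u n (fst z))" M "norm (snd z)" "\<Sum>c\<in>C. norm c"] by simp
  qed blast
  have "Cauchy (\<lambda>n. u (r n) t \<bullet> c)" if "c \<in> C" for t c
  proof (rule CauchyI)
    fix e :: real assume "e > 0"
    \<comment> \<open>Moving by less than \<open>d\<close> changes the coordinate by at most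
      \<open>e / 4\<close>, which leaves room for two such moves and a gap of \<open>e / 4\<close>
      at a rational time. Adding 1 keeps the denominator positive when \<open>L\<close> or
      \<open>c\<close> vanishes.\<close>
    define d where "d = e / (4 * (L + 1) * (norm c + 1))"
    have "d > 0" using \<open>e > 0\<close> L0 by (simp add: d_def add_nonneg_pos)
    obtain q where q: "q \<in> \<rat>" "t < q" "q < t + d"
      using Rats_dense_in_real[of t "t + d"] \<open>d > 0\<close> by auto
    have near: "\<bar>u n t \<bullet> c - u n q \<bullet> c\<bar> \<le> e / 4" for n
    proof -
      have "\<bar>u n t \<bullet> c - u n q \<bullet> c\<bar> \<le> norm (u n t - u n q) * norm c"
        using Cauchy_Schwarz_ineq2[of "u n t - u n q" c] by (simp add: inner_diff_left)
      also have "\<dots> \<le> (L * d) * norm c"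
        using L[of n t q] q L0 mult_left_mono[of "\<bar>t - q\<bar>" d L] by (intro mult_right_mono) auto
      also have "\<dots> \<le> ((L + 1) * d) * (norm c + 1)"
        by (intro mult_mono mult_nonneg_nonneg) (use L0 \<open>d > 0\<close> in auto)
      also have "\<dots> = e / 4"
      proof -
        have "L + 1 \<noteq> 0" "norm c + 1 \<noteq> 0" using L0 norm_ge_zero[of c] by linarith+
        moreover have "p * (e / (4 * p * q)) * q = e / 4" if "p \<noteq> 0" "q \<noteq> 0" for p q :: real
          using that by simp
        ultimately show ?thesis unfolding d_def by blast
      qed
      finally show ?thesis .
    qed
    have "convergent (\<lambda>n. u (r n) q \<bullet> c)"
      using conv[of "(q, c)"] q that by (auto simp: convergent_def)
    then obtain N where N: "\<And>m n. m \<ge> N \<Longrightarrow> n \<ge> N \<Longrightarrow> norm (u (r m) q \<bullet> c - u (r n) q \<bullet> c) < e / 4"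
      using CauchyD[OF convergent_Cauchy, of _ "e / 4"] \<open>e > 0\<close> by (metis divide_pos_pos zero_less_numeral)
    show "\<exists>N. \<forall>m\<ge>N. \<forall>n\<ge>N. norm (u (r m) t \<bullet> c - u (r n) t \<bullet> c) < e"
    proof (intro exI[of _ N] allI impI)
      fix m n assume "m \<ge> N" "n \<ge> N"
      then show "norm (u (r m) t \<bullet> c - u (r n) t \<bullet> c) < e"
        using N[OF \<open>m \<ge> N\<close> \<open>n \<ge> N\<close>] near[of "r m"] near[of "r n"]
        unfolding real_norm_def by linarith
    qed
  qed
  then have "\<forall>t. \<forall>c\<in>C. \<exists>l. (\<lambda>n. u (r n) t \<bullet> c) \<longlonglongrightarrow> l"
    using real_Cauchy_convergent convergent_def by blast
  then obtain l where l: "\<And>t c. c \<in> C \<Longrightarrow> (\<lambda>n. u (r n) t \<bullet> c) \<longlonglongrightarrow> l t c"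
    by metis
  show ?thesis
  proof
    show "strict_mono r" by fact
    show "(\<Sum>c\<in>C. (l t c / (c \<bullet> c)) *\<^sub>R c) \<in> F" for t
      unfolding C(2)[symmetric] by (intro span_sum span_scale span_base)
    show "(\<lambda>n. u (r n) t) \<longlonglongrightarrow> (\<Sum>c\<in>C. (l t c / (c \<bullet> c)) *\<^sub>R c)" for t
    proof -
      have "(\<lambda>n. \<Sum>c\<in>C. (u (r n) t \<bullet> c / (c \<bullet> c)) *\<^sub>R c) \<longlonglongrightarrow> (\<Sum>c\<in>C. (l t c / (c \<bullet> c)) *\<^sub>R c)"
        unfolding divide_inverse by (intro tendsto_intros l)
      then show ?thesis using expand[OF F(2)] by simp
    qed
  qed
qed

section \<open>Bounded homogeneous solutions with values in a subspace\<close>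

definition homogeneous_solutions :: "('a::real_inner \<Rightarrow> 'a) \<Rightarrow> 'a set \<Rightarrow> (real \<Rightarrow> 'a) set" where
  "homogeneous_solutions A F =
     {w. (\<forall>t. w t \<in> F) \<and> bounded (range w) \<and> weak_solution A w (\<lambda>t. 0)}"

lemma homogeneous_solutions_zero:
  "linear A \<Longrightarrow> subspace F \<Longrightarrow> (\<lambda>t. 0) \<in> homogeneous_solutions A F"
  by (simp add: homogeneous_solutions_def subspace_0 weak_solution_zero)

lemma homogeneous_solutions_add:
  assumes "linear A" "subspace F" "v \<in> homogeneous_solutions A F" "w \<in> homogeneous_solutions A F"
  shows "(\<lambda>t. v t + w t) \<in> homogeneous_solutions A F"
  using assms weak_solution_add[OF assms(1), of v "\<lambda>t. 0" w "\<lambda>t. 0"] bounded_plus_comp[of v UNIV w]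
  by (simp add: homogeneous_solutions_def subspace_add)

lemma homogeneous_solutions_scaleR:
  assumes "linear A" "subspace F" "w \<in> homogeneous_solutions A F"
  shows "(\<lambda>t. c *\<^sub>R w t) \<in> homogeneous_solutions A F"
  using assms weak_solution_scaleR[OF assms(1), of w "\<lambda>t. 0" c] bounded_scaleR_comp[of w UNIV c]
  by (simp add: homogeneous_solutions_def subspace_scale)

lemma homogeneous_solutions_diff:
  assumes "linear A" "subspace F" "v \<in> homogeneous_solutions A F" "w \<in> homogeneous_solutions A F"
  shows "(\<lambda>t. v t - w t) \<in> homogeneous_solutions A F"
  using homogeneous_solutions_add[OF assms(1-3) homogeneous_solutions_scaleR[OF assms(1,2,4), of "-1"]]
  by simp

lemma homogeneous_solutions_sum:
  assumes "linear A" "subspace F" "finite C" "\<And>c. c \<in> C \<Longrightarrow> w c \<in> homogeneous_solutions A F"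
  shows "(\<lambda>t. \<Sum>c\<in>C. w c t) \<in> homogeneous_solutions A F"
  using assms(3,4)
  by (induction C rule: finite_induct)
    (auto intro!: homogeneous_solutions_zero homogeneous_solutions_add assms(1,2))

lemma homogeneous_solutions_translate:
  assumes "w \<in> homogeneous_solutions A F"
  shows "(\<lambda>t. w (t + c)) \<in> homogeneous_solutions A F"
  using assms weak_solution_translate[of A w "\<lambda>t. 0" c]
    bounded_subset[of "range w" "range (\<lambda>t. w (t + c))"]
  by (auto simp: homogeneous_solutions_def)

lemma homogeneous_solutions_eq_zero:
  assumes "bounded_linear A" "w \<in> homogeneous_solutions A F" "w t0 = 0"
  shows "w t = 0"
proof -
  obtain M where M: "\<And>t. norm (w t) \<le> M" and "weak_solution A w (\<lambda>t. 0)"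
    using assms(2) by (auto simp: homogeneous_solutions_def bounded_iff)
  from homogeneous_unique[where A = A and w = w, OF assms(1) this(2,1) assms(3)]
  show ?thesis .
qed

lemma finite_dim_subspace_imp_subspace: "finite_dim_subspace F \<Longrightarrow> subspace F"
  by (auto simp: finite_dim_subspace_def)

text \<open>By uniqueness a bounded solution is determined linearly by its value at one time, and these
  values fill a finite-dimensional space.\<close>

lemma homogeneous_solutions_comparable:
  assumes A: "bounded_linear A" and F: "finite_dim_subspace F"
  obtains K where "\<And>w s t. w \<in> homogeneous_solutions A F \<Longrightarrow> norm (w t) \<le> K * norm (w s)"
proof -
  let ?E = "homogeneous_solutions A F"
  have lin: "linear A" using A bounded_linear.linear by blast
  have sub: "subspace F" using F by (rule finite_dim_subspace_imp_subspace)
  let ?W = "(\<lambda>w. w 0) ` ?E"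
  have "subspace ?W"
    unfolding subspace_def
  proof (intro conjI ballI allI)
    show "0 \<in> ?W"
      using homogeneous_solutions_zero[OF lin sub] by force
    show "x + y \<in> ?W" if "x \<in> ?W" "y \<in> ?W" for x y
      using that homogeneous_solutions_add[OF lin sub] by force
    show "c *\<^sub>R x \<in> ?W" if "x \<in> ?W" for c x
      using that homogeneous_solutions_scaleR[OF lin sub] by force
  qed
  moreover have "?W \<subseteq> F"
    by (auto simp: homogeneous_solutions_def)
  ultimately have "finite_dim_subspace ?W"
    by (rule finite_dim_subspace_subset[OF F])
  then obtain C where C: "finite C" "span C = ?W" "\<And>c. c \<in> C \<Longrightarrow> c \<noteq> 0"
    and expand: "\<And>x. x \<in> ?W \<Longrightarrow> x = (\<Sum>c\<in>C. (x \<bullet> c / (c \<bullet> c)) *\<^sub>R c)"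
    by (rule finite_dim_orthogonal_basis) blast
  have "\<forall>c\<in>C. \<exists>w\<in>?E. w 0 = c"
    using span_base[of _ C] C(2) by (metis (no_types, lifting) imageE)
  then obtain b where b: "\<And>c. c \<in> C \<Longrightarrow> b c \<in> ?E" "\<And>c. c \<in> C \<Longrightarrow> b c 0 = c"
    by metis
  have "\<forall>c\<in>C. \<exists>N. \<forall>t. norm (b c t) \<le> N"
    using b(1) by (auto simp: homogeneous_solutions_def bounded_iff)
  then obtain N where N: "\<And>c t. c \<in> C \<Longrightarrow> norm (b c t) \<le> N c"
    by metis
  show ?thesis
  proof
    fix w s t assume w: "w \<in> ?E"
    \<comment> \<open>Translation moves the reference time \<open>s\<close> to 0, where the basis of
      values is taken, so the constant does not depend on \<open>s\<close>.\<close>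
    define v where "v = (\<lambda>t. w (t + s))"
    have v: "v \<in> ?E" unfolding v_def by (rule homogeneous_solutions_translate[OF w])
    define a where "a c = v 0 \<bullet> c / (c \<bullet> c)" for c
    \<comment> \<open>\<open>v\<close> and this combination of the fixed solutions
      \<open>b c\<close> agree at time 0, so uniqueness identifies them at all times.\<close>
    have "(\<lambda>t. v t - (\<Sum>c\<in>C. a c *\<^sub>R b c t)) \<in> ?E"
      by (intro homogeneous_solutions_diff homogeneous_solutions_sum homogeneous_solutions_scaleR
          lin sub v C(1) b(1))
    moreover have "v 0 - (\<Sum>c\<in>C. a c *\<^sub>R b c 0) = 0"
      using expand[of "v 0"] v b(2) by (simp add: a_def)
    ultimately have "v (t - s) - (\<Sum>c\<in>C. a c *\<^sub>R b c (t - s)) = 0"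
      by (rule homogeneous_solutions_eq_zero[OF A])
    then have "norm (v (t - s)) \<le> (\<Sum>c\<in>C. norm (a c *\<^sub>R b c (t - s)))"
      using norm_sum[of "\<lambda>c. a c *\<^sub>R b c (t - s)" C] by simp
    also have "\<dots> \<le> (\<Sum>c\<in>C. N c / norm c * norm (v 0))"
    proof (rule sum_mono)
      fix c assume c: "c \<in> C"
      have "\<bar>a c\<bar> \<le> norm (v 0) / norm c"
        using Cauchy_Schwarz_ineq2[of "v 0" c] C(3)[OF c]
        by (simp add: a_def abs_divide power2_norm_eq_inner[symmetric] field_simps power2_eq_square)
      then have "\<bar>a c\<bar> * norm (b c (t - s)) \<le> norm (v 0) / norm c * N c"
        using N[OF c] by (intro mult_mono) auto
      then show "norm (a c *\<^sub>R b c (t - s)) \<le> N c / norm c * norm (v 0)"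
        by (simp add: mult.commute)
    qed
    finally show "norm (w t) \<le> (\<Sum>c\<in>C. N c / norm c) * norm (w s)"
      by (simp add: v_def sum_distrib_right)
  qed
qed

text \<open>The difference of \<open>w'\<close> and the translate of \<open>w\<close> by
  \<open>s n\<close> is again a bounded homogeneous solution. Its size at \<open>t - s n\<close> is
  controlled, uniformly in \<open>n\<close>, by its size at 0, which tends to 0.\<close>

lemma homogeneous_solution_recurrent:
  assumes A: "bounded_linear A" and F: "finite_dim_subspace F"
    and w: "w \<in> homogeneous_solutions A F" "w' \<in> homogeneous_solutions A F"
    and lim: "(\<lambda>n. w (s n)) \<longlonglongrightarrow> w' 0"
  shows "(\<lambda>n. w' (t - s n)) \<longlonglongrightarrow> w t"
proof -
  obtain K where K: "\<And>w s t. w \<in> homogeneous_solutions A F \<Longrightarrow> norm (w t) \<le> K * norm (w s)"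
    using homogeneous_solutions_comparable[OF A F] by blast
  have bound: "norm (w' (t - s n) - w t) \<le> K * norm (w' 0 - w (s n))" for n
    using K[OF homogeneous_solutions_diff[OF bounded_linear.linear[OF A]
          finite_dim_subspace_imp_subspace[OF F] w(2) homogeneous_solutions_translate[OF w(1), of "s n"]],
        of "t - s n" 0] by simp
  have "(\<lambda>n. K * norm (w' 0 - w (s n))) \<longlonglongrightarrow> K * norm (w' 0 - w' 0)"
    by (intro tendsto_intros lim)
  then have "(\<lambda>n. w' (t - s n) - w t) \<longlonglongrightarrow> 0"
    using Lim_null_comparison[OF eventuallyI[OF bound]] by simp
  then show ?thesis by (rule LIM_zero_cancel)
qed

section \<open>Almost automorphic solutions in finite dimension\<close>

lemma almost_automorphic_bounded:
  assumes "almost_automorphic \<psi>"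
  shows "bounded (range \<psi>)"
proof (rule ccontr)
  assume "\<not> bounded (range \<psi>)"
  then have "\<forall>n. \<exists>t. norm (\<psi> t) > real n"
    by (auto simp: bounded_iff not_le) 
  \<comment> \<open>Along such a sequence the values cannot have a convergent subsequence, which
    contradicts almost automorphy at \<open>t = 0\<close>.\<close>
  then obtain s where s: "\<And>n. norm (\<psi> (s n)) > real n" by metis
  obtain r \<psi>' where r: "strict_mono r" "\<And>t. (\<lambda>n. \<psi> (t + s (r n))) \<longlonglongrightarrow> \<psi>' t"
    using assms unfolding almost_automorphic_def by metis
  have "Bseq (\<lambda>n. \<psi> (s (r n)))"
    using r(2)[of 0] by (intro convergent_imp_Bseq convergentI) simp
  then obtain B where B: "\<And>n. norm (\<psi> (s (r n))) \<le> B"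
    by (auto simp: Bseq_def)
  obtain n where "B < real n" using reals_Archimedean2 by blast
  also have "real n \<le> real (r n)" using seq_suble[OF r(1)] by simp
  finally show False using s[of "r n"] B[of n] by linarith
qed

lemma LIMSEQ_strict_mono: "X \<longlonglongrightarrow> L \<Longrightarrow> strict_mono r \<Longrightarrow> (\<lambda>n. X (r n)) \<longlonglongrightarrow> L"
  using LIMSEQ_subseq_LIMSEQ[of X L r] by (simp add: o_def)

text \<open>A forward limit \<open>y'\<close> and a backward limit \<open>z\<close> are extracted by
  compactness. As \<open>z\<close> solves the same equation as \<open>y\<close>, it remains to show
  that the homogeneous defect \<open>w = z - y\<close> vanishes.\<close>

theorem almost_automorphic_finite_dim:
  fixes A :: "'a::real_inner \<Rightarrow> 'a"
  assumes A: "bounded_linear A" and F: "finite_dim_subspace F"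
    and g: "almost_automorphic g"
    and y: "\<And>t. (y has_vector_derivative A (y t) + g t) (at t)"
    and yF: "\<And>t. y t \<in> F" and bdd: "bounded (range y)"
  shows "almost_automorphic y"
  unfolding almost_automorphic_def
proof (intro conjI allI)
  show "continuous_on UNIV y"
    using y by (auto intro!: continuous_at_imp_continuous_on has_vector_derivative_continuous)
  fix s :: "nat \<Rightarrow> real"
  have lin: "linear A" using A bounded_linear.linear by blast
  have sub: "subspace F" using F by (rule finite_dim_subspace_imp_subspace)
  let ?E = "homogeneous_solutions A F"
  obtain M where M: "\<And>t. norm (y t) \<le> M" using bdd by (auto simp: bounded_iff)
  obtain G where G: "\<And>t. norm (g t) \<le> G"
    using almost_automorphic_bounded[OF g] by (auto simp: bounded_iff)
  obtain K where K: "K > 0" "\<And>z. norm (A z) \<le> norm z * K"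
    using bounded_linear.pos_bounded[OF A] by blast
  \<comment> \<open>One Lipschitz constant for all solutions with these bounds, so that subsequences
    can be selected both for the translates of \<open>y\<close> and for those of
    \<open>y'\<close>.\<close>
  have lip: "norm (u a - u b) \<le> (M * K + G) * \<bar>a - b\<bar>"
    if "weak_solution A u h" "\<And>t. norm (u t) \<le> M" "\<And>t. norm (h t) \<le> G" for u h a b
  proof (rule weak_solution_lipschitz[OF that(1)])
    fix t
    have "norm (A (u t)) \<le> M * K"
      using K(2)[of "u t"] mult_right_mono[OF that(2)[of t], of K] K(1) by linarith
    then show "norm (A (u t) + h t) \<le> M * K + G"
      using that(3)[of t] norm_triangle_ineq[of "A (u t)" "h t"] by linarith
  qed
  have sol: "weak_solution A y g" using y by (rule weak_solution_derivative)
  obtain r0 g' where r0: "strict_mono r0" "\<And>t. (\<lambda>n. g (t + s (r0 n))) \<longlonglongrightarrow> g' t"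
      "\<And>t. (\<lambda>n. g' (t - s (r0 n))) \<longlonglongrightarrow> g t"
    using g unfolding almost_automorphic_def by metis
  have G': "norm (g' t) \<le> G" for t
    by (rule LIMSEQ_le_const2[OF tendsto_norm[OF r0(2)]]) (use G in blast)
  obtain r1 y' where r1: "strict_mono r1" "\<And>t. y' t \<in> F"
      "\<And>t. (\<lambda>n. y (t + s (r0 (r1 n)))) \<longlonglongrightarrow> y' t"
    using lipschitz_convergent_subsequence[OF F, of "\<lambda>n t. y (t + s (r0 n))" M "M * K + G"]
      yF M lip[OF weak_solution_translate[OF sol]] G by metis
  have M': "norm (y' t) \<le> M" for t
    by (rule LIMSEQ_le_const2[OF tendsto_norm[OF r1(3)]]) (use M in blast)
  have sol': "weak_solution A y' g'"
    by (rule weak_solution_limit[OF A weak_solution_translate[OF sol] M G r1(3)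
          LIMSEQ_strict_mono[OF r0(2) r1(1)]])
  have sol'': "weak_solution A (\<lambda>t. y' (t - c)) (\<lambda>t. g' (t - c))" for c
    using weak_solution_translate[OF sol', of "-c"] by simp
  obtain r2 z where r2: "strict_mono r2" "\<And>t. z t \<in> F"
      "\<And>t. (\<lambda>n. y' (t - s (r0 (r1 (r2 n))))) \<longlonglongrightarrow> z t"
    using lipschitz_convergent_subsequence[OF F, of "\<lambda>n t. y' (t - s (r0 (r1 n)))" M "M * K + G"]
      r1(2) M' lip[OF sol''] G' by metis
  have Mz: "norm (z t) \<le> M" for t
    by (rule LIMSEQ_le_const2[OF tendsto_norm[OF r2(3)]]) (use M' in blast)
  have r12: "strict_mono (\<lambda>n. r1 (r2 n))"
    using strict_mono_o[OF r1(1) r2(1)] by (simp add: o_def)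
  \<comment> \<open>Going back restores the forcing term \<open>g\<close>, so \<open>z\<close> and
    \<open>y\<close> solve the same equation.\<close>
  have solz: "weak_solution A z g"
    by (rule weak_solution_limit[OF A sol'' M' G' r2(3) LIMSEQ_strict_mono[OF r0(3) r12]])
  define w where "w = (\<lambda>t. z t - y t)"
  have wE: "w \<in> ?E"
    using weak_solution_diff[OF lin solz sol] bounded_minus_comp[of z UNIV y] Mz bdd r2(2) yF sub
    by (auto simp: homogeneous_solutions_def w_def subspace_diff bounded_iff)
  obtain W where W: "\<And>t. norm (w t) \<le> W"
    using wE by (auto simp: homogeneous_solutions_def bounded_iff)
  define p where "p = (\<lambda>n. s (r0 (r1 (r2 n))))"
  have solw: "weak_solution A (\<lambda>t. w (t + c)) (\<lambda>t. 0)" for c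
    using homogeneous_solutions_translate[OF wE] by (simp add: homogeneous_solutions_def)
  have lipw: "norm (w (a + c) - w (b + c)) \<le> W * K * \<bar>a - b\<bar>" for a b c
  proof (rule weak_solution_lipschitz[OF solw])
    show "norm (A (w (\<tau> + c)) + 0) \<le> W * K" for \<tau>
      using order_trans[OF K(2)[of "w (\<tau> + c)"] mult_right_mono[OF W[of "\<tau> + c"], of K]] K(1)
      by simp
  qed
  have wF: "w t \<in> F" for t using wE by (simp add: homogeneous_solutions_def)
  \<comment> \<open>A further subsequence makes the translates of \<open>w\<close> converge as well,
    so that the forth-and-back procedure acts on \<open>y\<close> and \<open>w\<close>
    simultaneously.\<close>
  obtain r3 w' where r3: "strict_mono r3" "\<And>t. w' t \<in> F" "\<And>t. (\<lambda>n. w (t + p (r3 n))) \<longlonglongrightarrow> w' t"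
    using lipschitz_convergent_subsequence[OF F, of "\<lambda>n t. w (t + p n)" W "W * K"] wF W lipw by metis
  have W': "norm (w' t) \<le> W" for t
    by (rule LIMSEQ_le_const2[OF tendsto_norm[OF r3(3)]]) (use W in blast)
  have "weak_solution A w' (\<lambda>t. 0)"
    by (rule weak_solution_limit[where u = "\<lambda>n t. w (t + p (r3 n))" and g = "\<lambda>n t. 0" and G = 0,
          OF A solw W _ r3(3)]) auto
  then have w'E: "w' \<in> ?E"
    using W' r3(2) by (auto simp: homogeneous_solutions_def bounded_iff)
  \<comment> \<open>The return recovers \<open>w\<close> exactly, whereas that of \<open>y\<close>
    ends at \<open>z = y + w\<close>.\<close>
  have w_back: "(\<lambda>n. w' (t - p (r3 n))) \<longlonglongrightarrow> w t" for t
    by (rule homogeneous_solution_recurrent[OF A F wE w'E]) (use r3(3)[of 0] in simp)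
  have y_fwd: "(\<lambda>n. y (t + p (r3 n))) \<longlonglongrightarrow> y' t" for t
    using LIMSEQ_strict_mono[OF LIMSEQ_strict_mono[OF r1(3) r2(1)] r3(1)] by (simp add: p_def)
  have y_back: "(\<lambda>n. y' (t - p (r3 n))) \<longlonglongrightarrow> z t" for t
    using LIMSEQ_strict_mono[OF r2(3) r3(1)] by (simp add: p_def)
  \<comment> \<open>Going forth and back along \<open>p \<circ> r3\<close> does not increase the supremum norm, fixes \<open>w\<close>, and
    maps \<open>y\<close> to \<open>y + w\<close>; iterating it keeps \<open>y + m w\<close> bounded.\<close>
  have iter: "norm (y t + real m *\<^sub>R w t) \<le> M" for m t
  proof (induction m arbitrary: t)
    case 0
    then show ?case using M by simp
  next
    case (Suc m)
    have "norm (y' t + real m *\<^sub>R w' t) \<le> M" for t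
      by (rule LIMSEQ_le_const2[OF tendsto_norm[OF tendsto_add[OF y_fwd tendsto_scaleR[OF tendsto_const r3(3)]]]])
        (use Suc.IH in blast)
    then have "norm (z t + real m *\<^sub>R w t) \<le> M"
      by (intro LIMSEQ_le_const2[OF tendsto_norm[OF tendsto_add[OF y_back tendsto_scaleR[OF tendsto_const w_back]]]])
        blast
    then show ?case by (simp add: w_def algebra_simps)
  qed
  have "w t = 0" for t
  proof (rule ccontr)
    assume "w t \<noteq> 0"
    \<comment> \<open>Then \<open>real m * norm (w t)\<close> exceeds \<open>2 * M\<close>, which is
      too much for \<open>y t\<close> and \<open>y t + real m *\<^sub>R w t\<close> both to be
      bounded by \<open>M\<close>.\<close>
    obtain m where m: "2 * M / norm (w t) < real m" using reals_Archimedean2 by blast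
    have "real m * norm (w t) \<le> norm (y t + real m *\<^sub>R w t) + norm (y t)"
      using norm_triangle_ineq4[of "y t + real m *\<^sub>R w t" "y t"] by simp
    also have "\<dots> \<le> 2 * M" using iter[of t m] M[of t] by simp
    finally show False using m \<open>w t \<noteq> 0\<close> by (simp add: field_simps)
  qed
  then have "z = y" by (auto simp: w_def)
  show "\<exists>r. strict_mono r \<and> (\<exists>\<psi>'. \<forall>t. (\<lambda>n. y (t + s (r n))) \<longlonglongrightarrow> \<psi>' t \<and>
      (\<lambda>n. \<psi>' (t - s (r n))) \<longlonglongrightarrow> y t)"
  proof (intro exI conjI allI)
    \<comment> \<open>\<open>r3\<close> served to prove \<open>w = 0\<close>; with
      \<open>z = y\<close>, the return to \<open>y\<close> already holds along the earlier
      subsequence.\<close>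
    show "strict_mono (\<lambda>n. r0 (r1 (r2 n)))"
      using strict_mono_o[OF r0(1) r12] by (simp add: o_def)
    show "(\<lambda>n. y (t + s (r0 (r1 (r2 n))))) \<longlonglongrightarrow> y' t" for t
      by (rule LIMSEQ_strict_mono[OF r1(3) r2(1)])
    show "(\<lambda>n. y' (t - s (r0 (r1 (r2 n))))) \<longlonglongrightarrow> y t" for t
      using r2(3) \<open>z = y\<close> by simp
  qed
qed

section \<open>Compact operators on Hilbert sums\<close>

lemma compact_operator_bounded_linear:
  assumes "compact_operator A"
  shows "bounded_linear A"
proof -
  have lin: "linear A" and "compact (closure (A ` cball 0 1))"
    using assms bounded_cball by (auto simp: compact_operator_def)
  then have "bounded (A ` cball 0 1)"
    using compact_imp_bounded bounded_subset closure_subset by blast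
  then obtain K where "\<forall>x\<in>cball 0 1. norm (A x) \<le> K"
    by (auto simp: bounded_iff)
  then have K: "norm (A x) \<le> K" if "norm x \<le> 1" for x
    using that by simp
  have "norm (A x) \<le> norm x * K" for x
  proof (cases "x = 0")
    case True
    then show ?thesis by (simp add: linear_0[OF lin])
  next
    case False
    have "norm (A (inverse (norm x) *\<^sub>R x)) \<le> K"
      by (rule K) (use False in simp)
    then show ?thesis
      using False by (simp add: linear_scale[OF lin] field_simps)
  qed
  then show ?thesis
    using lin by (auto intro!: bounded_linear.intro bounded_linear_axioms.intro)
qed

text \<open>The definition only asks for an orthogonal decomposition of each vector. Its uniqueness
  yields linearity, and Cauchy-Schwarz applied to \<open>P x \<bullet> P x = P x \<bullet> x\<close>
  yields the norm bound 1.\<close>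

lemma orthogonal_projection_on_bounded_linear:
  assumes W: "subspace W" and P: "orthogonal_projection_on W P"
  shows "bounded_linear P"
proof -
  have PW: "P x \<in> W" and orth: "z \<in> W \<Longrightarrow> z \<bullet> (x - P x) = 0" for x z
    using P by (auto simp: orthogonal_projection_on_def orthogonal_comp_def orthogonal_def)
  have unique: "P x = v" if "v \<in> W" "\<And>z. z \<in> W \<Longrightarrow> z \<bullet> (x - v) = 0" for x v
  proof -
    have "P x - v \<in> W" using PW that(1) W by (simp add: subspace_diff)
    then have "(P x - v) \<bullet> (x - v) - (P x - v) \<bullet> (x - P x) = 0"
      using orth that(2) by simp
    then have "(P x - v) \<bullet> (P x - v) = 0"
      by (simp add: inner_diff_right)
    then show ?thesis by simp
  qed
  show ?thesis
  proof (rule bounded_linear_intro[where K = 1])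
    show "P (x + y) = P x + P y" for x y
    proof (rule unique)
      fix z assume "z \<in> W"
      then show "z \<bullet> (x + y - (P x + P y)) = 0"
        using orth[of z x] orth[of z y] by (simp add: inner_simps)
    qed (use PW W in \<open>simp add: subspace_add\<close>)
    show "P (c *\<^sub>R x) = c *\<^sub>R P x" for c x
    proof (rule unique)
      fix z assume "z \<in> W"
      then show "z \<bullet> (c *\<^sub>R x - c *\<^sub>R P x) = 0"
        using orth[of z x] by (simp add: inner_simps)
    qed (use PW W in \<open>simp add: subspace_scale\<close>)
    show "norm (P x) \<le> norm x * 1" for x
    proof -
      have "P x \<bullet> P x = P x \<bullet> x" using orth[OF PW, of x x] by (simp add: inner_simps)
      then have "norm (P x) * norm (P x) \<le> norm (P x) * norm x"
        using norm_cauchy_schwarz[of "P x" x] by (simp add: power2_norm_eq_inner[symmetric] power2_eq_square)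
      then show ?thesis by (cases "P x = 0") auto
    qed
  qed
qed

lemma orthogonal_projection_on_inner:
  assumes "orthogonal_projection_on W P" "z \<in> W"
  shows "P x \<bullet> z = x \<bullet> z"
proof -
  have "z \<bullet> (x - P x) = 0"
    using assms by (simp add: orthogonal_projection_on_def orthogonal_comp_def orthogonal_def)
  then show ?thesis by (simp add: inner_diff_right inner_commute)
qed

text \<open>The vectors orthogonal to \<open>x\<close> form a closed subspace; as it contains
  \<open>S\<close>, it is the whole space and contains \<open>x\<close> itself.\<close>

lemma orthogonal_to_dense_span:
  fixes x :: "'a::real_inner"
  assumes dense: "closure (span S) = UNIV" and orth: "\<And>z. z \<in> S \<Longrightarrow> x \<bullet> z = 0"
  shows "x = 0"
proof -
  have "span S \<subseteq> {z. x \<bullet> z = 0}"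
    using orth by (intro span_minimal subspace_hyperplane) auto
  then have "closure (span S) \<subseteq> {z. x \<bullet> z = 0}"
    by (rule closure_minimal) (rule closed_hyperplane)
  then have "x \<bullet> x = 0" using dense by blast
  then show ?thesis by simp
qed

text \<open>Obtained by normalising a nearby vector of the dense span. Norms can thus be detected by
  finite linear combinations of component vectors, whose inner products are controlled by
  componentwise limits.\<close>

lemma dense_span_almost_norming:
  fixes x :: "'a::real_inner"
  assumes "closure (span S) = UNIV" "d > 0"
  obtains z where "z \<in> span S" "norm z \<le> 1" "norm x - d < x \<bullet> z"
proof -
  obtain v where v: "v \<in> span S" "dist v x < d / 2"
    using assms closure_approachable[of x "span S"] by (metis UNIV_I half_gt_zero)
  \<comment> \<open>\<open>sgn v\<close> is the unit vector along \<open>v\<close>, and 0 if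
    \<open>v = 0\<close>, which also settles that degenerate case.\<close>
  have "v \<bullet> sgn v = norm v"
    by (cases "v = 0") (simp_all add: sgn_div_norm power2_norm_eq_inner[symmetric] power2_eq_square)
  moreover have sgn_le: "norm (sgn v) \<le> 1" by (simp add: norm_sgn)
  then have "\<bar>(x - v) \<bullet> sgn v\<bar> \<le> norm (x - v)"
    using Cauchy_Schwarz_ineq2[of "x - v" "sgn v"] mult_left_mono[OF sgn_le, of "norm (x - v)"] by simp
  moreover have "norm x \<le> norm v + norm (x - v)"
    using norm_triangle_ineq[of v "x - v"] by simp
  ultimately have "norm x - d < x \<bullet> sgn v"
    using v(2) by (simp add: dist_norm norm_minus_commute inner_diff_left)
  moreover have "sgn v \<in> span S"
    using v(1) by (simp add: sgn_div_norm span_scale)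
  ultimately show ?thesis using that sgn_le by blast
qed

section \<open>Almost automorphy under linear maps and for sequences of functions\<close>

lemma almost_automorphic_linear:
  assumes P: "bounded_linear P" and f: "almost_automorphic f"
  shows "almost_automorphic (\<lambda>t. P (f t))"
  unfolding almost_automorphic_def
proof (intro conjI allI)
  show "continuous_on UNIV (\<lambda>t. P (f t))"
    using f by (intro bounded_linear.continuous_on[OF P]) (simp add: almost_automorphic_def)
  fix s :: "nat \<Rightarrow> real"
  obtain r f' where r: "strict_mono r"
      "\<And>t. (\<lambda>n. f (t + s (r n))) \<longlonglongrightarrow> f' t" "\<And>t. (\<lambda>n. f' (t - s (r n))) \<longlonglongrightarrow> f t"
    using f unfolding almost_automorphic_def by metis
  show "\<exists>r. strict_mono r \<and> (\<exists>\<psi>'. \<forall>t. (\<lambda>n. P (f (t + s (r n)))) \<longlonglongrightarrow> \<psi>' t \<and>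
      (\<lambda>n. \<psi>' (t - s (r n))) \<longlonglongrightarrow> P (f t))"
    using r
    by (intro exI[of _ r] conjI exI[of _ "\<lambda>t. P (f' t)"] allI bounded_linear.tendsto[OF P]) auto
qed

text \<open>Diagonal argument: being a good subsequence for one \<open>f k\<close> passes to further
  subsequences and ignores finitely many initial terms, so the diagonal sequence is good for all
  \<open>k\<close> at once.\<close>

lemma almost_automorphic_common_subsequence:
  fixes f :: "nat \<Rightarrow> real \<Rightarrow> 'a::real_normed_vector"
  assumes "\<And>k. almost_automorphic (f k)"
  obtains r f' where "strict_mono (r :: nat \<Rightarrow> nat)"
    "\<And>k t. (\<lambda>n. f k (t + s (r n))) \<longlonglongrightarrow> f' k t"
    "\<And>k t. (\<lambda>n. f' k (t - s (r n))) \<longlonglongrightarrow> f k t"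
proof -
  define Q where "Q k r \<longleftrightarrow> (\<exists>f'. \<forall>t. (\<lambda>n. f k (t + s (r n))) \<longlonglongrightarrow> f' t \<and>
      (\<lambda>n. f' (t - s (r n))) \<longlonglongrightarrow> f k t)" for k and r :: "nat \<Rightarrow> nat"
  interpret subseqs Q
  proof
    fix k and r :: "nat \<Rightarrow> nat"
    show "\<exists>r'. strict_mono r' \<and> Q k (r \<circ> r')"
      using assms[of k] unfolding almost_automorphic_def Q_def
      by (auto simp: o_def dest!: spec[of _ "\<lambda>n. s (r n)"])
  qed
  have "Q k diagseq" for k
  proof -
    \<comment> \<open>From index \<open>Suc k\<close> on, the diagonal sequence is a subsequence of
      the one selected for \<open>f k\<close>; \<open>LIMSEQ_offset\<close> removes the shift
      afterwards.\<close>
    have "Q k (diagseq \<circ> ((+) (Suc k)))"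
    proof (rule diagseq_holds)
      fix r r' :: "nat \<Rightarrow> nat" and k assume r': "strict_mono r'" and "Q k r"
      then obtain f' where "\<And>t. (\<lambda>n. f k (t + s (r n))) \<longlonglongrightarrow> f' t"
          "\<And>t. (\<lambda>n. f' (t - s (r n))) \<longlonglongrightarrow> f k t"
        unfolding Q_def by blast
      from this[THEN LIMSEQ_strict_mono, OF r'] show "Q k (r \<circ> r')"
        unfolding Q_def o_def by (intro exI[of _ f'] allI conjI)
    qed
    then obtain f' where "\<And>t. (\<lambda>n. f k (t + s (diagseq (n + Suc k)))) \<longlonglongrightarrow> f' t"
        "\<And>t. (\<lambda>n. f' (t - s (diagseq (n + Suc k)))) \<longlonglongrightarrow> f k t"
      unfolding Q_def o_def add.commute[of "Suc k"] by blast
    from this[THEN LIMSEQ_offset] show ?thesis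
      unfolding Q_def by (intro exI[of _ f'] allI conjI)
  qed
  then have "\<exists>f'. \<forall>k t. (\<lambda>n. f k (t + s (diagseq n))) \<longlonglongrightarrow> f' k t \<and>
      (\<lambda>n. f' k (t - s (diagseq n))) \<longlonglongrightarrow> f k t"
    unfolding Q_def by (intro choice allI)
  then obtain f' where "\<And>k t. (\<lambda>n. f k (t + s (diagseq n))) \<longlonglongrightarrow> f' k t"
      "\<And>k t. (\<lambda>n. f' k (t - s (diagseq n))) \<longlonglongrightarrow> f k t"
    by blast
  with subseq_diagseq show ?thesis by (rule that)
qed

section \<open>Strong convergence from convergence of the components\<close>

locale hilbert_sum_operator =
  fixes A :: "'v::{real_inner, complete_space} \<Rightarrow> 'v"
    and V :: "nat \<Rightarrow> 'v set"
    and P :: "nat \<Rightarrow> 'v \<Rightarrow> 'v"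
  assumes compact: "compact_operator A"
    and sum: "hilbert_sum V"
    and projection: "\<And>k. orthogonal_projection_on (V k) (P k)"
    and commute: "\<And>k. P k \<circ> A = A \<circ> P k"
begin

lemma bounded_linear_A: "bounded_linear A"
  by (rule compact_operator_bounded_linear[OF compact])

lemma bounded_linear_P: "bounded_linear (P k)"
  by (rule orthogonal_projection_on_bounded_linear[OF _ projection])
    (use sum in \<open>simp add: hilbert_sum_def\<close>)

lemma commute_apply: "P k (A x) = A (P k x)"
  using fun_cong[OF commute[of k], of x] by simp

lemma dense: "closure (span (\<Union>k. V k)) = UNIV"
  using sum by (simp add: hilbert_sum_def)

lemma P_range: "P k x \<in> V k"
  using projection by (simp add: orthogonal_projection_on_def)

lemma components_zero:
  assumes "\<And>k. P k x = 0"
  shows "x = 0"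
proof (rule orthogonal_to_dense_span[OF dense])
  fix z assume "z \<in> (\<Union>k. V k)"
  then obtain k where "z \<in> V k" by blast
  then show "x \<bullet> z = 0"
    using orthogonal_projection_on_inner[OF projection[of k], of z x] assms[of k] by simp
qed

text \<open>If \<open>A (d n)\<close> stayed away from 0 along a subsequence, compactness would give
  a limit \<open>x\<close> along a further one. By commutation \<open>P k x\<close> is the limit of
  \<open>A (P k (d n))\<close>, which is 0 for every \<open>k\<close>; so \<open>x = 0\<close>, a
  contradiction.\<close>

lemma components_null_imp_A_null:
  assumes d: "\<And>n. norm (d n) \<le> M" and lim: "\<And>k. (\<lambda>n. P k (d n)) \<longlonglongrightarrow> 0"
  shows "(\<lambda>n. A (d n)) \<longlonglongrightarrow> 0"
proof (rule ccontr)
  assume "\<not> (\<lambda>n. A (d n)) \<longlonglongrightarrow> 0"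
  then obtain e where e: "e > 0" "\<And>N. \<exists>n\<ge>N. e \<le> norm (A (d n))"
    by (auto simp: LIMSEQ_iff not_less)
  define S where "S = {n. e \<le> norm (A (d n))}"
  have "infinite S"
    using e(2) by (auto simp: S_def infinite_nat_iff_unbounded_le)
  then obtain r :: "nat \<Rightarrow> nat" where r: "strict_mono r" "\<And>n. r n \<in> S"
    using infinite_enumerate by blast
  have "bounded (range d)" using d by (auto simp: bounded_iff)
  then have cpt: "compact (closure (A ` range d))"
    using compact by (simp add: compact_operator_def)
  have mem: "A (d (r n)) \<in> closure (A ` range d)" for n
    by (rule subsetD[OF closure_subset]) auto
  obtain x r' where r': "strict_mono r'" "(\<lambda>n. A (d (r (r' n)))) \<longlonglongrightarrow> x"
    using seq_compactE[OF compact_imp_seq_compact[OF cpt], of "\<lambda>n. A (d (r n))"] mem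
    unfolding o_def by blast
  have "x = 0"
  proof (rule components_zero)
    fix k
    have "(\<lambda>n. P k (A (d (r (r' n))))) \<longlonglongrightarrow> P k x"
      by (rule bounded_linear.tendsto[OF bounded_linear_P r'(2)])
    moreover have "(\<lambda>n. A (P k (d (r (r' n))))) \<longlonglongrightarrow> A 0"
      by (intro bounded_linear.tendsto[OF bounded_linear_A] LIMSEQ_strict_mono[OF _ r'(1)]
          LIMSEQ_strict_mono[OF lim r(1)])
    ultimately show "P k x = 0"
      using LIMSEQ_unique by (fastforce simp: commute_apply linear_0 bounded_linear.linear[OF bounded_linear_A])
  qed
  then have "e \<le> norm (0 :: 'v)"
    using r(2) by (intro LIMSEQ_le_const[OF tendsto_norm[OF r'(2)[unfolded \<open>x = 0\<close>]]])
      (auto simp: S_def)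
  with e(1) show False by simp
qed

text \<open>Testing the weak equation against \<open>d n b - d n a\<close> itself gives
  \<open>\<parallel>d n b - d n a\<parallel>\<^sup>2\<close> on the right-hand side, with an integrand that tends to 0.\<close>

lemma increment_null:
  assumes sol: "\<And>n. weak_solution A (d n) (h n)"
    and bdd: "\<And>n t. norm (d n t) \<le> M" "\<And>n t. norm (h n t) \<le> G"
    and lim: "\<And>k t. (\<lambda>n. P k (d n t)) \<longlonglongrightarrow> 0" "\<And>t. (\<lambda>n. h n t) \<longlonglongrightarrow> 0"
  shows "(\<lambda>n. d n b - d n a) \<longlonglongrightarrow> 0"
proof -
  have *: "(\<lambda>n. d n b - d n a) \<longlonglongrightarrow> 0" if "a \<le> b" for a b
  proof -
    define x where "x n = d n b - d n a" for n
    obtain K where K: "K > 0" "\<And>z. norm (A z) \<le> norm z * K"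
      using bounded_linear.pos_bounded[OF bounded_linear_A] by blast
    have x: "norm (x n) \<le> 2 * M" for n
      using norm_triangle_ineq4[of "d n b" "d n a"] bdd(1)[of n a] bdd(1)[of n b]
      by (simp add: x_def)
    have rhs: "norm (A (d n \<tau>) + h n \<tau>) \<le> M * K + G" for n \<tau>
      using K(2)[of "d n \<tau>"] mult_right_mono[OF bdd(1)[of n \<tau>], of K] K(1) bdd(2)[of n \<tau>]
        norm_triangle_ineq[of "A (d n \<tau>)" "h n \<tau>"] by linarith
    have int: "((\<lambda>\<tau>. (A (d n \<tau>) + h n \<tau>) \<bullet> x n) has_integral x n \<bullet> x n) {a..b}" for n
      using weak_solutionD[OF sol \<open>a \<le> b\<close>] by (simp add: x_def)
    \<comment> \<open>The test vector \<open>x n\<close> varies with \<open>n\<close> but is bounded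
      by \<open>2 * M\<close>, so convergence of \<open>A (d n \<tau>) + h n \<tau>\<close> to 0 is
      enough for the integrand.\<close>
    have "(\<lambda>n. integral {a..b} (\<lambda>\<tau>. (A (d n \<tau>) + h n \<tau>) \<bullet> x n)) \<longlonglongrightarrow> integral {a..b} (\<lambda>\<tau>. 0)"
    proof (rule dominated_convergence(2))
      show "(\<lambda>\<tau>. (A (d n \<tau>) + h n \<tau>) \<bullet> x n) integrable_on {a..b}" for n
        using int by blast
      show "(\<lambda>\<tau>. (M * K + G) * (2 * M)) integrable_on {a..b}"
        by (rule integrable_const_ivl)
      show "norm ((A (d n \<tau>) + h n \<tau>) \<bullet> x n) \<le> (M * K + G) * (2 * M)" for n \<tau>
        using Cauchy_Schwarz_ineq2[of "A (d n \<tau>) + h n \<tau>" "x n"] rhs[of n \<tau>] x[of n]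
          mult_mono[OF rhs[of n \<tau>] x[of n] order_trans[OF norm_ge_zero rhs[of n \<tau>]] norm_ge_zero]
        by simp
      show "(\<lambda>n. (A (d n \<tau>) + h n \<tau>) \<bullet> x n) \<longlonglongrightarrow> 0" for \<tau>
      proof (rule Lim_null_comparison)
        show "\<forall>\<^sub>F n in sequentially. norm ((A (d n \<tau>) + h n \<tau>) \<bullet> x n) \<le>
            norm (A (d n \<tau>) + h n \<tau>) * (2 * M)"
        proof (rule eventuallyI)
          fix n
          show "norm ((A (d n \<tau>) + h n \<tau>) \<bullet> x n) \<le> norm (A (d n \<tau>) + h n \<tau>) * (2 * M)"
            using Cauchy_Schwarz_ineq2[of "A (d n \<tau>) + h n \<tau>" "x n"]
              mult_left_mono[OF x[of n] norm_ge_zero[of "A (d n \<tau>) + h n \<tau>"]] by simp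
        qed
        have "(\<lambda>n. A (d n \<tau>) + h n \<tau>) \<longlonglongrightarrow> 0 + 0"
          by (intro tendsto_add lim(2) 
              components_null_imp_A_null[where d = "\<lambda>n. d n \<tau>", OF bdd(1) lim(1)])
        then show "(\<lambda>n. norm (A (d n \<tau>) + h n \<tau>) * (2 * M)) \<longlonglongrightarrow> 0"
          by (intro tendsto_mult_left_zero tendsto_norm_zero) simp
      qed
    qed
    then have "(\<lambda>n. x n \<bullet> x n) \<longlonglongrightarrow> 0"
      by (simp only: integral_unique[OF int] integral_0)
    then have "(\<lambda>n. sqrt (x n \<bullet> x n)) \<longlonglongrightarrow> sqrt 0"
      by (rule tendsto_real_sqrt)
    then show ?thesis
      by (simp add: norm_eq_sqrt_inner[symmetric] tendsto_norm_zero_iff x_def)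
  qed
  show ?thesis
  proof (cases "a \<le> b")
    case False
    then show ?thesis using tendsto_minus[OF *[of b a]] by simp
  qed (rule *)
qed

text \<open>If \<open>u n\<close> were not Cauchy at one time, the differences of its far terms would, by
  \<open>increment_null\<close>, stay away from 0 at every time, and the parallelogram law would keep the weak
  limit uniformly below the bound \<open>m\<close>.\<close>

lemma strongly_convergent:
  assumes sol: "\<And>n. weak_solution A (u n) (g n)"
    and bdd: "\<And>n t. norm (u n t) \<le> m" "\<And>n t. norm (g n t) \<le> G"
    and conv: "\<And>k t. convergent (\<lambda>n. P k (u n t))" "\<And>t. convergent (\<lambda>n. g n t)"
    and sharp: "\<And>\<delta>. \<delta> > 0 \<Longrightarrow> \<exists>t z l. norm z \<le> 1 \<and> (\<lambda>n. u n t \<bullet> z) \<longlonglongrightarrow> l \<and> m - \<delta> < l"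
  shows "convergent (\<lambda>n. u n t0)"
proof -
  have "Cauchy (\<lambda>n. u n t0)"
  proof (rule ccontr)
    assume "\<not> Cauchy (\<lambda>n. u n t0)"
    then obtain e where e: "e > 0" "\<And>N. \<exists>p\<ge>N. \<exists>q\<ge>N. e \<le> norm (u p t0 - u q t0)"
      unfolding Cauchy_iff by (meson not_le)
    then obtain p q where pq: "\<And>N. p N \<ge> N" "\<And>N. q N \<ge> N"
        "\<And>N. e \<le> norm (u (p N) t0 - u (q N) t0)"
      by metis
    \<comment> \<open>\<open>p\<close> and \<open>q\<close> may fail to be monotone; tending to
      infinity suffices for composing them with convergent sequences.\<close>
    have sub: "filterlim p at_top sequentially" "filterlim q at_top sequentially"
      using pq(1,2) by (auto intro: filterlim_at_top_mono[OF filterlim_ident])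
    have m0: "0 \<le> m" using bdd(1)[of 0 0] norm_ge_zero order_trans by blast
    define d where "d N = (\<lambda>t. u (p N) t - u (q N) t)" for N
    have incr: "(\<lambda>N. d N t - d N t0) \<longlonglongrightarrow> 0" for t
    proof (rule increment_null)
      show "weak_solution A (d N) (\<lambda>t. g (p N) t - g (q N) t)" for N
        unfolding d_def
        by (rule weak_solution_diff[OF bounded_linear.linear[OF bounded_linear_A] sol sol])
      show "norm (d N t) \<le> 2 * m" for N t
        using norm_triangle_ineq4[of "u (p N) t" "u (q N) t"] bdd(1)[of "p N" t] bdd(1)[of "q N" t]
        by (simp add: d_def)
      show "norm (g (p N) t - g (q N) t) \<le> 2 * G" for N t
        using norm_triangle_ineq4[of "g (p N) t" "g (q N) t"] bdd(2)[of "p N" t] bdd(2)[of "q N" t]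
        by simp
      show "(\<lambda>N. P k (d N t)) \<longlonglongrightarrow> 0" for k t
      proof -
        obtain l where l: "(\<lambda>n. P k (u n t)) \<longlonglongrightarrow> l" using conv(1) by (auto simp: convergent_def)
        have "(\<lambda>N. P k (u (p N) t) - P k (u (q N) t)) \<longlonglongrightarrow> l - l"
          by (intro tendsto_diff filterlim_compose[OF l] sub)
        then show ?thesis
          by (simp add: d_def linear_diff[OF bounded_linear.linear[OF bounded_linear_P]])
      qed
      show "(\<lambda>N. g (p N) t - g (q N) t) \<longlonglongrightarrow> 0" for t
      proof -
        obtain l where l: "(\<lambda>n. g n t) \<longlonglongrightarrow> l" using conv(2) by (auto simp: convergent_def)
        have "(\<lambda>N. g (p N) t - g (q N) t) \<longlonglongrightarrow> l - l"
          by (intro tendsto_diff filterlim_compose[OF l] sub)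
        then show ?thesis by simp
      qed
    qed
    \<comment> \<open>Chosen so that \<open>8 * m * \<delta> < e\<^sup>2\<close>: then
      \<open>4 * l\<^sup>2 \<ge> 4 * m\<^sup>2 - 8 * m * \<delta>\<close>, a consequence of
      \<open>m - \<delta> < l\<close>, contradicts the parallelogram estimate. The summand 1 covers
      \<open>m = 0\<close>.\<close>
    define \<delta> where "\<delta> = e\<^sup>2 / (16 * (m + 1))"
    have "\<delta> > 0" using e(1) m0 by (simp add: \<delta>_def)
    obtain t z l where z: "norm z \<le> 1" "(\<lambda>n. u n t \<bullet> z) \<longlonglongrightarrow> l" "m - \<delta> < l"
      using sharp[OF \<open>\<delta> > 0\<close>] by blast
    \<comment> \<open>The parallelogram law for two far terms, in the limit: their sum is bounded
      below by its pairing with \<open>z\<close>, their difference by its size at \<open>t0\<close>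
      minus its change between \<open>t0\<close> and \<open>t\<close>. The maximum with 0 keeps that
      lower bound nonnegative, as squaring requires.\<close>
    have le: "(l + l)\<^sup>2 + e\<^sup>2 \<le> 4 * m\<^sup>2"
    proof (rule LIMSEQ_le_const2)
      show "(\<lambda>N. (u (p N) t \<bullet> z + u (q N) t \<bullet> z)\<^sup>2 + (max 0 (e - norm (d N t - d N t0)))\<^sup>2)
          \<longlonglongrightarrow> (l + l)\<^sup>2 + e\<^sup>2"
      proof (intro tendsto_add tendsto_power filterlim_compose[OF z(2)] sub)
        have "(\<lambda>N. max 0 (e - norm (d N t - d N t0))) \<longlonglongrightarrow> max 0 (e - norm (0 :: 'v))"
          by (intro tendsto_max tendsto_diff tendsto_const tendsto_norm incr)
        then show "(\<lambda>N. max 0 (e - norm (d N t - d N t0))) \<longlonglongrightarrow> e"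
          using e(1) by (simp add: max_absorb2)
      qed
      show "\<exists>N. \<forall>n\<ge>N. (u (p n) t \<bullet> z + u (q n) t \<bullet> z)\<^sup>2 + (max 0 (e - norm (d n t - d n t0)))\<^sup>2
          \<le> 4 * m\<^sup>2"
      proof (intro exI allI impI)
        fix n
        let ?a = "u (p n) t" and ?b = "u (q n) t"
        have "\<bar>(?a + ?b) \<bullet> z\<bar> \<le> norm (?a + ?b)"
          using Cauchy_Schwarz_ineq2[of "?a + ?b" z]
            mult_left_mono[OF z(1) norm_ge_zero[of "?a + ?b"]] by simp
        then have 1: "(?a \<bullet> z + ?b \<bullet> z)\<^sup>2 \<le> (norm (?a + ?b))\<^sup>2"
          using power_mono[of "\<bar>(?a + ?b) \<bullet> z\<bar>" "norm (?a + ?b)" 2] by (simp add: inner_add_left)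
        have "norm (d n t0) \<le> norm (d n t) + norm (d n t - d n t0)"
          using norm_triangle_ineq4[of "d n t" "d n t - d n t0"] by simp
        then have "max 0 (e - norm (d n t - d n t0)) \<le> norm (?a - ?b)"
          using pq(3)[of n] by (simp add: d_def)
        then have 2: "(max 0 (e - norm (d n t - d n t0)))\<^sup>2 \<le> (norm (?a - ?b))\<^sup>2"
          by (intro power_mono) auto
        have "(norm (?a + ?b))\<^sup>2 + (norm (?a - ?b))\<^sup>2 = 2 * (norm ?a)\<^sup>2 + 2 * (norm ?b)\<^sup>2"
          by (simp add: power2_norm_eq_inner inner_simps inner_commute)
        moreover have "(norm ?a)\<^sup>2 \<le> m\<^sup>2" "(norm ?b)\<^sup>2 \<le> m\<^sup>2"
          by (intro power_mono bdd norm_ge_zero)+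
        ultimately show "(?a \<bullet> z + ?b \<bullet> z)\<^sup>2 + (max 0 (e - norm (d n t - d n t0)))\<^sup>2 \<le> 4 * m\<^sup>2"
          using 1 2 by linarith
      qed
    qed
    \<comment> \<open>Squaring \<open>m - \<delta> < l\<close> requires a nonnegative left-hand
      side, hence the case distinction.\<close>
    have "m\<^sup>2 - 2 * m * \<delta> \<le> l\<^sup>2"
    proof (cases "m \<le> \<delta>")
      case True
      then have "m * m \<le> m * (2 * \<delta>)" using m0 \<open>\<delta> > 0\<close> by (intro mult_left_mono) auto
      then have "m\<^sup>2 - 2 * m * \<delta> \<le> 0" by (simp add: power2_eq_square algebra_simps)
      then show ?thesis using zero_le_power2[of l] by linarith
    next
      case False
      then have "(m - \<delta>)\<^sup>2 \<le> l\<^sup>2" using z(3) by (intro power_mono) auto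
      moreover have "(m - \<delta>)\<^sup>2 = m\<^sup>2 - 2 * m * \<delta> + \<delta>\<^sup>2" by (simp add: power2_diff)
      ultimately show ?thesis using zero_le_power2[of \<delta>] by linarith
    qed
    moreover have "(l + l)\<^sup>2 = 4 * l\<^sup>2" by (simp add: power2_eq_square)
    moreover have "8 * m * \<delta> < e\<^sup>2"
    proof -
      have "\<delta> * (16 * (m + 1)) = e\<^sup>2" using m0 by (simp add: \<delta>_def)
      moreover have "\<delta> * (16 * (m + 1)) = 8 * m * \<delta> + (8 * (m * \<delta>) + 16 * \<delta>)"
        by (simp add: algebra_simps)
      moreover have "0 \<le> m * \<delta>" using m0 \<open>\<delta> > 0\<close> by simp
      ultimately show ?thesis using \<open>\<delta> > 0\<close> by linarith
    qed
    ultimately show False using le by linarith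
  qed
  then show ?thesis by (rule Cauchy_convergent)
qed

end

section \<open>From the components to the solution in the whole space\<close>

theorem theorem3p6:
  fixes A :: "'v::{real_inner, complete_space} \<Rightarrow> 'v"
    and V :: "nat \<Rightarrow> 'v set"
    and P :: "nat \<Rightarrow> 'v \<Rightarrow> 'v"
    and f y :: "real \<Rightarrow> 'v"
  assumes "compact_operator A"
    and "hilbert_sum V"
    and "\<And>k. finite_dim_subspace (V k)"
    and "\<And>k. orthogonal_projection_on (V k) (P k)"
    and "\<And>k. P k \<circ> A = A \<circ> P k"
    and "almost_automorphic f"
    and "\<And>t. (y has_vector_derivative A (y t) + f t) (at t)"
    and "bounded (range y)"
  shows "almost_automorphic y"
  unfolding almost_automorphic_def
proof (intro conjI allI)
  interpret hilbert_sum_operator A V P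
    by unfold_locales (fact assms)+
  have lin_P: "linear (P k)" for k by (rule bounded_linear.linear[OF bounded_linear_P])
  show "continuous_on UNIV y"
    using assms(7)
    by (auto intro!: continuous_at_imp_continuous_on has_vector_derivative_continuous)
  fix s :: "nat \<Rightarrow> real"
  obtain G where G: "\<And>t. norm (f t) \<le> G"
    using almost_automorphic_bounded[OF assms(6)] by (auto simp: bounded_iff)
  have bdd: "bdd_above (range (\<lambda>t. norm (y t)))"
    using assms(8) by (auto simp: bounded_iff bdd_above_def)
  \<comment> \<open>The exact supremum: the strong convergence argument needs a bound that the weak
    limits approach arbitrarily closely.\<close>
  define m where "m = (SUP t. norm (y t))"
  have m: "norm (y t) \<le> m" for t
    unfolding m_def by (rule cSUP_upper[OF UNIV_I bdd])
  have sol: "weak_solution A y f"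
    using assms(7) by (rule weak_solution_derivative)
  \<comment> \<open>Commutation turns the projected equation into one for \<open>P k (y t)\<close>
    with forcing term \<open>P k (f t)\<close>, to which the finite-dimensional result
    applies.\<close>
  have comp_aa: "almost_automorphic (\<lambda>t. P k (y t))" for k
  proof (rule almost_automorphic_finite_dim[OF bounded_linear_A assms(3)
        almost_automorphic_linear[OF bounded_linear_P assms(6)]])
    show "((\<lambda>t. P k (y t)) has_vector_derivative A (P k (y t)) + P k (f t)) (at t)" for t
      using bounded_linear.has_vector_derivative[OF bounded_linear_P assms(7)]
      by (simp add: linear_add[OF lin_P] commute_apply)
    show "P k (y t) \<in> V k" for t by (rule P_range)
    show "bounded (range (\<lambda>t. P k (y t)))"
      using bounded_linear_image[OF assms(8) bounded_linear_P, of k] by (simp add: image_image)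
  qed
  \<comment> \<open>Index 0 carries \<open>f\<close> and index \<open>Suc j\<close> the component
    \<open>P j (y t)\<close>, so that one subsequence serves all of them.\<close>
  define F where "F k = (case k of 0 \<Rightarrow> f | Suc j \<Rightarrow> \<lambda>t. P j (y t))" for k
  have F: "almost_automorphic (F k)" for k
    using assms(6) comp_aa by (simp add: F_def split: nat.split)
  obtain r F' where r: "strict_mono (r :: nat \<Rightarrow> nat)"
      and F': "\<And>k t. (\<lambda>n. F k (t + s (r n))) \<longlonglongrightarrow> F' k t"
        "\<And>k t. (\<lambda>n. F' k (t - s (r n))) \<longlonglongrightarrow> F k t"
    by (rule almost_automorphic_common_subsequence[where f = F and s = s, OF F]) blast
  define f' where "f' = F' 0"
  define z where "z k = F' (Suc k)" for k
  have f': "(\<lambda>n. f (t + s (r n))) \<longlonglongrightarrow> f' t" "(\<lambda>n. f' (t - s (r n))) \<longlonglongrightarrow> f t" for t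
    using F'[of 0 t] by (simp_all add: F_def f'_def)
  have z: "(\<lambda>n. P k (y (t + s (r n)))) \<longlonglongrightarrow> z k t" "(\<lambda>n. z k (t - s (r n))) \<longlonglongrightarrow> P k (y t)" for k t
    using F'[of "Suc k" t] by (simp_all add: F_def z_def)
  have G': "norm (f' t) \<le> G" for t
    by (rule LIMSEQ_le_const2[OF tendsto_norm[OF f'(1)]]) (use G in blast)
  \<comment> \<open>For a vector of some \<open>V k\<close> the pairing only sees the component
    \<open>P k (y t)\<close>, whose forth-and-back limits are known; linearity extends this to the
    span.\<close>
  have weak: "\<exists>l. \<forall>t. (\<lambda>n. y (t + s (r n)) \<bullet> x) \<longlonglongrightarrow> l t \<and> (\<lambda>n. l (t - s (r n))) \<longlonglongrightarrow> y t \<bullet> x"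
    if "x \<in> span (\<Union>k. V k)" for x
    using that
  proof (induction rule: span_induct_alt)
    case base
    show ?case by (intro exI[of _ "\<lambda>t. 0"]) simp
  next
    case (step c v x)
    then obtain k l where "v \<in> V k"
      and l: "\<And>t. (\<lambda>n. y (t + s (r n)) \<bullet> x) \<longlonglongrightarrow> l t" "\<And>t. (\<lambda>n. l (t - s (r n))) \<longlonglongrightarrow> y t \<bullet> x"
      by blast
    note P_inner = orthogonal_projection_on_inner[OF projection \<open>v \<in> V k\<close>]
    have v: "(\<lambda>n. y (t + s (r n)) \<bullet> v) \<longlonglongrightarrow> z k t \<bullet> v"
        "(\<lambda>n. z k (t - s (r n)) \<bullet> v) \<longlonglongrightarrow> y t \<bullet> v" for t
      using tendsto_inner[OF z(1)[of k t] tendsto_const[of v]]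
        tendsto_inner[OF z(2)[of k t] tendsto_const[of v]] by (simp_all add: P_inner)
    show ?case
    proof (intro exI[of _ "\<lambda>t. c * (z k t \<bullet> v) + l t"] allI conjI)
      fix t
      show "(\<lambda>n. y (t + s (r n)) \<bullet> (c *\<^sub>R v + x)) \<longlonglongrightarrow> c * (z k t \<bullet> v) + l t"
        unfolding inner_add_right inner_scaleR_right by (intro tendsto_intros v l)
      show "(\<lambda>n. c * (z k (t - s (r n)) \<bullet> v) + l (t - s (r n))) \<longlonglongrightarrow> y t \<bullet> (c *\<^sub>R v + x)"
        unfolding inner_add_right inner_scaleR_right by (intro tendsto_intros v l)
    qed
  qed
  \<comment> \<open>A time at which \<open>norm (y t)\<close> is within \<open>\<delta> / 2\<close>
    of the supremum, and then a test vector that loses less than another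
    \<open>\<delta> / 2\<close>.\<close>
  have sharp: "\<exists>t x. x \<in> span (\<Union>k. V k) \<and> norm x \<le> 1 \<and> m - \<delta> < y t \<bullet> x" if pos: "\<delta> > 0" for \<delta>
  proof -
    have "m - \<delta> / 2 < m" using pos by simp
    then obtain t where t: "m - \<delta> / 2 < norm (y t)"
      using less_cSUP_iff[OF UNIV_not_empty bdd, of "m - \<delta> / 2"] by (auto simp: m_def)
    obtain x where "x \<in> span (\<Union>k. V k)" "norm x \<le> 1" "norm (y t) - \<delta> / 2 < y t \<bullet> x"
      using dense_span_almost_norming[OF dense half_gt_zero[OF pos], of "y t"] by blast
    moreover from this(3) t have "m - \<delta> < y t \<bullet> x" by linarith
    ultimately show ?thesis by blast
  qed
  have "convergent (\<lambda>n. y (t + s (r n)))" for t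
  proof (rule strongly_convergent[where u = "\<lambda>n t. y (t + s (r n))" and g = "\<lambda>n t. f (t + s (r n))"])
    show "weak_solution A (\<lambda>t. y (t + s (r n))) (\<lambda>t. f (t + s (r n)))" for n
      by (rule weak_solution_translate[OF sol])
    show "convergent (\<lambda>n. P k (y (t + s (r n))))" for k t
      using z(1) by (rule convergentI)
    show "convergent (\<lambda>n. f (t + s (r n)))" for t
      using f'(1) by (rule convergentI)
    show "\<exists>t x l. norm x \<le> 1 \<and> (\<lambda>n. y (t + s (r n)) \<bullet> x) \<longlonglongrightarrow> l \<and> m - \<delta> < l" if "\<delta> > 0" for \<delta>
    proof -
      obtain t x where tx: "x \<in> span (\<Union>k. V k)" "norm x \<le> 1" "m - \<delta> < y t \<bullet> x"
        using sharp[OF \<open>\<delta> > 0\<close>] by blast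
      obtain l where l: "\<And>t. (\<lambda>n. y (t + s (r n)) \<bullet> x) \<longlonglongrightarrow> l t"
          "\<And>t. (\<lambda>n. l (t - s (r n))) \<longlonglongrightarrow> y t \<bullet> x"
        using weak[OF tx(1)] by blast
      \<comment> \<open>Going back, \<open>l\<close> returns to \<open>y t \<bullet> x\<close>,
        which exceeds \<open>m - \<delta>\<close>; so \<open>l\<close> itself exceeds it at some
        translated time, and the forward weak limit comes close to \<open>m\<close>.\<close>
      obtain n where "m - \<delta> < l (t - s (r n))"
        using eventually_happens'[OF sequentially_bot order_tendstoD(1)[OF l(2) tx(3)]] by blast
      with tx(2) show ?thesis
        by (intro exI[of _ "t - s (r n)"] exI[of _ x] exI[of _ "l (t - s (r n))"] conjI l(1))
    qed
  qed (rule m G)+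
  then obtain y' where y': "\<And>t. (\<lambda>n. y (t + s (r n))) \<longlonglongrightarrow> y' t"
    unfolding convergent_def by metis
  have m': "norm (y' t) \<le> m" for t
    by (rule LIMSEQ_le_const2[OF tendsto_norm[OF y']]) (use m in blast)
  have sol': "weak_solution A y' f'"
    by (rule weak_solution_limit[OF bounded_linear_A weak_solution_translate[OF sol] m G y' f'(1)])
  have comp': "P k (y' t) = z k t" for k t
    by (rule LIMSEQ_unique[OF bounded_linear.tendsto[OF bounded_linear_P y'] z(1)])
  \<comment> \<open>The same argument for the way back, with the bounds \<open>m\<close> and
    \<open>G\<close> inherited by the limits. Here the pairings converge to those of
    \<open>y\<close>, so sharpness holds at the time \<open>t\<close> itself.\<close>
  have "convergent (\<lambda>n. y' (t - s (r n)))" for t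
  proof (rule strongly_convergent[where u = "\<lambda>n t. y' (t - s (r n))" and g = "\<lambda>n t. f' (t - s (r n))"])
    show "weak_solution A (\<lambda>t. y' (t - s (r n))) (\<lambda>t. f' (t - s (r n)))" for n
      using weak_solution_translate[OF sol', of "- s (r n)"] by simp
    show "convergent (\<lambda>n. P k (y' (t - s (r n))))" for k t
      unfolding comp' using z(2) by (rule convergentI)
    show "convergent (\<lambda>n. f' (t - s (r n)))" for t
      using f'(2) by (rule convergentI)
    show "\<exists>t x l. norm x \<le> 1 \<and> (\<lambda>n. y' (t - s (r n)) \<bullet> x) \<longlonglongrightarrow> l \<and> m - \<delta> < l" if "\<delta> > 0" for \<delta>
    proof -
      obtain t x where tx: "x \<in> span (\<Union>k. V k)" "norm x \<le> 1" "m - \<delta> < y t \<bullet> x"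
        using sharp[OF \<open>\<delta> > 0\<close>] by blast
      obtain l where l: "\<And>t. (\<lambda>n. y (t + s (r n)) \<bullet> x) \<longlonglongrightarrow> l t"
          "\<And>t. (\<lambda>n. l (t - s (r n))) \<longlonglongrightarrow> y t \<bullet> x"
        using weak[OF tx(1)] by blast
      have "l t = y' t \<bullet> x" for t
        by (rule LIMSEQ_unique[OF l(1) tendsto_inner[OF y' tendsto_const]])
      with l(2)[of t] tx show ?thesis
        by (intro exI[of _ t] exI[of _ x] exI[of _ "y t \<bullet> x"] conjI) simp_all
    qed
  qed (rule m' G')+
  \<comment> \<open>The strong limit has the same components as \<open>y t\<close>, and these
    determine a vector.\<close>
  have y'_back: "(\<lambda>n. y' (t - s (r n))) \<longlonglongrightarrow> y t" for t
  proof -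
    obtain l where l: "(\<lambda>n. y' (t - s (r n))) \<longlonglongrightarrow> l"
      using \<open>\<And>t. convergent (\<lambda>n. y' (t - s (r n)))\<close> by (auto simp: convergent_def)
    have Pl: "P k l = P k (y t)" for k
      using LIMSEQ_unique[OF bounded_linear.tendsto[OF bounded_linear_P l] z(2)[folded comp']] .
    have "l - y t = 0"
      by (rule components_zero) (simp add: linear_diff[OF lin_P] Pl)
    with l show ?thesis by simp
  qed
  show "\<exists>r. strict_mono r \<and> (\<exists>\<psi>'. \<forall>t. (\<lambda>n. y (t + s (r n))) \<longlonglongrightarrow> \<psi>' t \<and>
      (\<lambda>n. \<psi>' (t - s (r n))) \<longlonglongrightarrow> y t)"
    by (intro exI[of _ r] exI[of _ y'] allI conjI r y' y'_back)
qed

end
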